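(* For every integer $n\ge0$, $$P_{100}(n)=\sum_{j,k\ge0}q^{j^2+k^2+j}{2n-k-1\brack j}_{q^2}{j\brack k}_{q^2}+q^{4n-1}\sum_{j,k\ge0}q^{j^2+k^2+j}{2n-k-2\brack j}_{q^2}{j\brack k}_{q^2}.$$
   Context: For partitions $\lambda=(\lambda_1,\lambda_2,\dots)$, $\mu=(\mu_1,\mu_2,\dots)$ (weakly decreasing, padded by zeros) write $\lambda\succeq\mu$ if $\lambda_1\ge\mu_1\ge\lambda_2\ge\mu_2\ge\cdots$ and $\lambda\preceq\mu$ if $\mu_1\ge\lambda_1\ge\mu_2\ge\lambda_2\ge\cdots$. A skew double shifted plane partition (DSPP) with profile $\delta=\delta_1\delta_2\delta_3\in\{0,1\}^3$ is a 4-tuple of integer partitions $(\lambda^0,\lambda^1,\lambda^2,\lambda^3)$ with $\lambda^{j-1}\succeq\lambda^j$ if $\delta_j=0$ and $\lambda^{j-1}\preceq\lambda^j$ if $\delta_j=1$ ($j=1,2,3$). Its size $|\Lambda|$ is the sum of all parts of the four partitions; its diagonal length is the maximum of the numbers of (positive) parts of the four partitions. Let $\mathrm{DSPP}_{100}(n)$ be the set of DSPPs with profile $100$ and diagonal length at most $n$, $F_{100}(n)=\sum_{\Lambda\in\mathrm{DSPP}_{100}(n)}q^{|\Lambda|}$, and $P_{100}(n)=(q;q)_{4n}F_{100}(n)$. Here $(a;q)_0=1$, $(a;q)_n=\prod_{i=0}^{n-1}(1-aq^i)$ for $n\ge1$, and ${n\brack m}_q=\frac{(q;q)_n}{(q;q)_m(q;q)_{n-m}}$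 if $n\ge m\ge0$ and $0$ otherwise; ${n\brack m}_{q^2}$ is the same with $q\to q^2$.
   Formalization: The identity is stated for n ≥ 1 instead of n ≥ 0, since at n = 0 it fails: P_100(0) = 1, while all q-binomials on the right have negative upper entry and vanish, so the right side is 0. *)

theory Defs
  imports
    "HOL-Computational_Algebra.Formal_Power_Series"
    "HOL-Library.Groups_Big_Fun"
begin

text \<open>
  A partition is its infinite sequence of parts, padded by zeros. Indices start at 0, so
  \<open>p i\<close> is the (\<open>i + 1\<close>)-st part.
\<close>

type_synonym parts = "nat \<Rightarrow> nat"

definition is_partition :: "parts \<Rightarrow> bool" where
  "is_partition p \<longleftrightarrow> antimono p \<and> finite {i. p i > 0}"

definition num_parts :: "parts \<Rightarrow> nat" where
  "num_parts p = card {i. p i > 0}"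

definition part_sum :: "parts \<Rightarrow> nat" where
  "part_sum p = (\<Sum>i | p i > 0. p i)"

definition interlaces :: "parts \<Rightarrow> parts \<Rightarrow> bool" (infix "\<succeq>" 50) where
  "p \<succeq> r \<longleftrightarrow> (\<forall>i. p i \<ge> r i \<and> r i \<ge> p (Suc i))"

abbreviation interlaced_by :: "parts \<Rightarrow> parts \<Rightarrow> bool" (infix "\<preceq>" 50) where
  "p \<preceq> r \<equiv> r \<succeq> p"

definition profile_step :: "nat \<Rightarrow> parts \<Rightarrow> parts \<Rightarrow> bool" where
  "profile_step d p r \<longleftrightarrow> (d = 0 \<and> p \<succeq> r) \<or> (d = 1 \<and> p \<preceq> r)"

type_synonym parts4 = "parts \<times> parts \<times> parts \<times> parts"

fun is_dspp :: "nat \<times> nat \<times> nat \<Rightarrow> parts4 \<Rightarrow> bool" where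
  "is_dspp (d1, d2, d3) (l0, l1, l2, l3) \<longleftrightarrow>
     is_partition l0 \<and> is_partition l1 \<and> is_partition l2 \<and> is_partition l3 \<and>
     profile_step d1 l0 l1 \<and> profile_step d2 l1 l2 \<and> profile_step d3 l2 l3"

fun dspp_size :: "parts4 \<Rightarrow> nat" where
  "dspp_size (l0, l1, l2, l3) = part_sum l0 + part_sum l1 + part_sum l2 + part_sum l3"

fun diagonal_length :: "parts4 \<Rightarrow> nat" where
  "diagonal_length (l0, l1, l2, l3) =
     Max {num_parts l0, num_parts l1, num_parts l2, num_parts l3}"

definition DSPP :: "nat \<times> nat \<times> nat \<Rightarrow> nat \<Rightarrow> parts4 set" where
  "DSPP \<delta> n = {\<Lambda>. is_dspp \<delta> \<Lambda> \<and> diagonal_length \<Lambda> \<le> n}"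

text \<open>
  The generating function of the sizes; the sets counted are finite, since a partition of size at
  most \<open>N\<close> has at most \<open>N\<close> parts, each at most \<open>N\<close>.
\<close>

definition DSPP_gf :: "nat \<times> nat \<times> nat \<Rightarrow> nat \<Rightarrow> rat fps" where
  "DSPP_gf \<delta> n = Abs_fps (\<lambda>N. of_nat (card {\<Lambda> \<in> DSPP \<delta> n. dspp_size \<Lambda> = N}))"

definition qpoch :: "rat fps \<Rightarrow> rat fps \<Rightarrow> nat \<Rightarrow> rat fps" where
  "qpoch a q n = (\<Prod>i<n. 1 - a * q ^ i)"

text \<open>
  The arguments are integers because the upper one may be negative; the coefficient then
  vanishes, also when \<open>m = 0\<close>. The division is exact for \<open>q\<close> with constant coefficient 0, where
  the denominator is a unit of the power series ring.
\<close>

definition qbinom :: "rat fps \<Rightarrow> int \<Rightarrow> int \<Rightarrow> rat fps" where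
  "qbinom q n m =
     (if n \<ge> m \<and> m \<ge> 0
      then qpoch q q (nat n) / (qpoch q q (nat m) * qpoch q q (nat (n - m)))
      else 0)"

text \<open>
  Note that \<open>P100 0 = 1\<close> (only the quadruple of empty partitions is counted), whereas all the upper
  entries \<open>2 * n - k - 1\<close> and \<open>2 * n - k - 2\<close> are negative for \<open>n = 0\<close>, so that the double sums
  over q-binomial coefficients vanish there; the double-sum formula therefore needs \<open>n \<ge> 1\<close>.
\<close>

definition P100 :: "nat \<Rightarrow> rat fps" where
  "P100 n = qpoch fps_X fps_X (4 * n) * DSPP_gf (1, 0, 0) n"

end

theory Submission
  imports Defs
begin

text \<open>
  The four diagonals of a double shifted plane partition of profile \<open>100\<close> satisfy
  \<open>\<lambda>\<^sup>1 \<succeq> \<lambda>\<^sup>0\<close> and \<open>\<lambda>\<^sup>1 \<succeq> \<lambda>\<^sup>2 \<succeq> \<lambda>\<^sup>3\<close>. Shuffling the parts of \<open>\<lambda>\<^sup>1\<close> and \<open>\<lambda>\<^sup>0\<close> gives one weakly decreasing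
  sequence \<open>x\<close>, shuffling those of \<open>\<lambda>\<^sup>2\<close> and \<open>\<lambda>\<^sup>3\<close> another one, \<open>y\<close>, and the only remaining condition,
  \<open>\<lambda>\<^sup>1 \<succeq> \<lambda>\<^sup>2\<close>, reads \<open>x (2 * i) \<ge> y (2 * i) \<ge> x (2 * i + 2)\<close>. So the objects counted are P-partitions of
  a poset of width two, consisting of two interlocking chains.

  Let \<open>W X Y\<close> be \<open>(q; q)\<close> of length \<open>X + Y\<close> times the generating function of the pairs in which \<open>x\<close> and
  \<open>y\<close> vanish from the positions \<open>X\<close> and \<open>Y\<close> on (\<open>numerator\<close> below). Either one of the
  chains has a zero at its last position before \<open>X\<close> or \<open>Y\<close>, or 1 can be subtracted from all the entries
  before \<open>X\<close> and \<open>Y\<close>. If the shape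
  \<open>(X + 1, Y + 1)\<close> is compatible with the interlocking, inclusion and exclusion therefore yield
  \[ W (X + 1) (Y + 1) = W X (Y + 1) + W (X + 1) Y - (1 - q^{X+Y+1}) W X Y \]
  (\<open>numerator_Suc_Suc\<close>). There are at most two compatible shapes of each size \<open>X + Y\<close>, so that
  the recurrence is essentially one-dimensional: for \<open>a m = W (m + 1) m\<close> it becomes
  \[ a (m + 2) = (1 + q^{2m+4}) a (m + 1) + q^{2m+3} a m \]
  (\<open>numerator_rec\<close>), and \<open>W (2 * n) (2 * n)\<close> equals \<open>a (2 * n - 1)\<close> plus \<open>q\<close> to the power \<open>4 * n - 1\<close>
  times \<open>a (2 * n - 2)\<close> (\<open>numerator_diagonal\<close>). These are the two terms of the claim:
  the double sum with upper entries \<open>m - k\<close> satisfies the same recurrence (\<open>double_sum_rec\<close>).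
  To see that, expand the first q-binomial coefficient of its summand by one q-Pascal rule and,
  in the new terms, the second coefficient by the other rule; the powers of \<open>q\<close> combine so that
  exactly two shifted copies of the double sum appear.
\<close>

section \<open>q-Pascal rules\<close>

lemma qpoch_Suc: "qpoch p p (Suc n) = qpoch p p n * (1 - p ^ Suc n)"
  by (simp add: qpoch_def)

lemma qpoch_nonzero:
  assumes "fps_nth p 0 = 0"
  shows "qpoch p p n \<noteq> 0"
proof -
  have "fps_nth (1 - p ^ Suc i) 0 = 1" for i
    using assms by (simp add: fps_mult_nth)
  then have "1 - p ^ Suc i \<noteq> 0" for i
    by (metis fps_zero_nth zero_neq_one)
  then show ?thesis
    by (simp add: qpoch_def)
qed

lemma qpoch_unit:
  assumes "fps_nth p 0 = 0"
  shows "qpoch p p n dvd 1"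
proof -
  have "fps_nth (qpoch p p n) 0 = 1"
    by (induction n) (simp_all add: qpoch_Suc fps_mult_nth assms qpoch_def[of _ _ 0])
  then show ?thesis
    by (simp add: fps_is_unit_iff)
qed

lemma qbinom_mult_qpoch:
  assumes "fps_nth p 0 = 0" and "m \<le> n"
  shows "qbinom p (int n) (int m) * (qpoch p p m * qpoch p p (n - m)) = qpoch p p n"
proof -
  have "qpoch p p m * qpoch p p (n - m) dvd 1"
    using qpoch_unit[OF assms(1)] by (metis mult_dvd_mono mult_1)
  then have "qpoch p p m * qpoch p p (n - m) dvd qpoch p p n"
    by (meson dvd_trans one_dvd)
  then show ?thesis
    using assms(2) by (simp add: qbinom_def nat_diff_distrib')
qed

lemma qbinom_eq_0: "n < m \<Longrightarrow> qbinom p n m = 0"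
  by (simp add: qbinom_def)

lemma qbinom_0: "fps_nth p 0 = 0 \<Longrightarrow> qbinom p (int n) 0 = 1"
  using qbinom_mult_qpoch[of p 0 n] qpoch_nonzero[of p n] by (simp add: qpoch_def[of _ _ 0])

lemma qbinom_self: "fps_nth p 0 = 0 \<Longrightarrow> qbinom p (int n) (int n) = 1"
  using qbinom_mult_qpoch[of p n n] qpoch_nonzero[of p n] by (simp add: qpoch_def[of _ _ 0])

text \<open>
  The three entries of a Pascal triangle relation over the common denominator \<open>d\<close>. Both q-Pascal
  rules then reduce to polynomial identities in \<open>p\<close>.
\<close>

lemma qbinom_Suc_Suc_mult:
  assumes p: "fps_nth p 0 = 0" and "m < n"
  defines "d \<equiv> qpoch p p (Suc m) * qpoch p p (n - m)"
  shows "d \<noteq> 0"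
    and "qbinom p (int (Suc n)) (int (Suc m)) * d = qpoch p p n * (1 - p ^ Suc n)"
    and "qbinom p (int n) (int (Suc m)) * d = qpoch p p n * (1 - p ^ (n - m))"
    and "qbinom p (int n) (int m) * d = qpoch p p n * (1 - p ^ Suc m)"
proof -
  show "d \<noteq> 0"
    using qpoch_nonzero[OF p] by (simp add: d_def)
  show "qbinom p (int (Suc n)) (int (Suc m)) * d = qpoch p p n * (1 - p ^ Suc n)"
    using qbinom_mult_qpoch[OF p, of "Suc m" "Suc n"] assms(2)
    by (simp only: d_def qpoch_Suc diff_Suc_Suc Suc_le_mono less_imp_le)
  have "n - m = Suc (n - Suc m)"
    using assms(2) by simp
  then have "d = qpoch p p (Suc m) * qpoch p p (n - Suc m) * (1 - p ^ (n - m))"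
    unfolding d_def by (metis mult.assoc qpoch_Suc)
  then show "qbinom p (int n) (int (Suc m)) * d = qpoch p p n * (1 - p ^ (n - m))"
    using qbinom_mult_qpoch[OF p, of "Suc m" n] assms(2)
    by (metis Suc_leI mult.assoc)
  have "d = qpoch p p m * qpoch p p (n - m) * (1 - p ^ Suc m)"
    by (simp add: d_def qpoch_Suc mult_ac)
  then show "qbinom p (int n) (int m) * d = qpoch p p n * (1 - p ^ Suc m)"
    using qbinom_mult_qpoch[OF p, of m n] assms(2)
    by (metis less_imp_le mult.assoc)
qed

text \<open>
  The rule holds for all integers \<open>n\<close>, although q-binomial coefficients with a negative upper entry
  vanish even if the lower entry is 0: the only instance that this convention breaks is the one with
  value 1 on the left for \<open>n = -1\<close> and lower entry 0, which \<open>Suc j\<close> excludes.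
\<close>

lemma qbinom_pascal_upper:
  assumes p: "fps_nth p 0 = 0"
  shows "qbinom p (n + 1) (int (Suc j)) =
    qbinom p n (int (Suc j)) + p ^ nat (n - int j) * qbinom p n (int j)"
proof (cases "n < int j")
  case True
  then show ?thesis by (simp add: qbinom_eq_0)
next
  case False
  then obtain N where n: "n = int N" and N: "j \<le> N"
    using zero_le_imp_eq_int[of n] by force
  show ?thesis
  proof (cases "N = j")
    case True
    then show ?thesis
      using qbinom_self[OF p, of j] qbinom_self[OF p, of "Suc j"] qbinom_eq_0[of "int j" "1 + int j" p]
      by (simp add: n add.commute)
  next
    case False
    with N have less: "j < N" by simp
    let ?d = "qpoch p p (Suc j) * qpoch p p (N - j)"
    note facts = qbinom_Suc_Suc_mult[OF p less]
    have pow: "p ^ (N - j) * p ^ Suc j = p ^ Suc N"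
      using less by (simp flip: power_add del: power_Suc)
    have "(qbinom p n (int (Suc j)) + p ^ (N - j) * qbinom p n (int j)) * ?d =
        qbinom p (int N) (int (Suc j)) * ?d + p ^ (N - j) * (qbinom p (int N) (int j) * ?d)"
      by (simp add: n algebra_simps)
    also have "\<dots> = qpoch p p N * (1 - p ^ (N - j) * p ^ Suc j)"
      unfolding facts(3,4) by (simp add: algebra_simps)
    also have "\<dots> = qbinom p (int (Suc N)) (int (Suc j)) * ?d"
      by (simp only: facts(2) pow)
    finally show ?thesis
      using facts(1) less by (simp add: n nat_diff_distrib' add.commute)
  qed
qed

lemma qbinom_pascal_lower:
  assumes p: "fps_nth p 0 = 0"
  shows "qbinom p (int (Suc n)) (int (Suc m)) =
    p ^ Suc m * qbinom p (int n) (int (Suc m)) + qbinom p (int n) (int m)"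
proof (cases "m < n")
  case True
  let ?d = "qpoch p p (Suc m) * qpoch p p (n - m)"
  note facts = qbinom_Suc_Suc_mult[OF p True]
  have pow: "p ^ Suc m * p ^ (n - m) = p ^ Suc n"
    using True by (simp flip: power_add del: power_Suc)
  have "(p ^ Suc m * qbinom p (int n) (int (Suc m)) + qbinom p (int n) (int m)) * ?d =
      p ^ Suc m * (qbinom p (int n) (int (Suc m)) * ?d) + qbinom p (int n) (int m) * ?d"
    by (simp only: algebra_simps)
  also have "\<dots> = qpoch p p n * (1 - p ^ Suc m * p ^ (n - m))"
    unfolding facts(3,4) by (simp add: algebra_simps)
  also have "\<dots> = qbinom p (int (Suc n)) (int (Suc m)) * ?d"
    by (simp only: facts(2) pow)
  finally show ?thesis
    using facts(1) by (metis mult_right_cancel)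
next
  case False
  then consider "m = n" | "n < m" by linarith
  then show ?thesis
    by cases (use qbinom_self[OF p] in \<open>simp_all add: qbinom_eq_0 del: of_nat_Suc\<close>)
qed

section \<open>The recurrence of the double sum\<close>

definition summand :: "int \<Rightarrow> nat \<Rightarrow> nat \<Rightarrow> rat fps" where
  "summand m j k = fps_X ^ (j\<^sup>2 + k\<^sup>2 + j) * qbinom (fps_X\<^sup>2) (m - int k) (int j)
     * qbinom (fps_X\<^sup>2) (int j) (int k)"

definition double_sum :: "int \<Rightarrow> rat fps" where
  "double_sum m = Sum_any (\<lambda>(j, k). summand m j k)"

lemma summand_nonzeroD: "summand m j k \<noteq> 0 \<Longrightarrow> int j + int k \<le> m"
  by (auto simp: summand_def qbinom_def split: if_splits)

lemma double_sum_eq: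
  assumes "m \<le> int J" "m \<le> int K"
  shows "double_sum m = (\<Sum>j\<le>J. \<Sum>k\<le>K. summand m j k)"
proof -
  have "Sum_any (\<lambda>(j, k). summand m j k) = (\<Sum>(j, k) \<in> {..J} \<times> {..K}. summand m j k)"
    using assms by (intro Sum_any.expand_superset) (force dest: summand_nonzeroD)+
  then show ?thesis
    by (simp add: double_sum_def sum.cartesian_product)
qed

text \<open>
  The next three lemmas are the recurrence of the double sum on the level of summands. They make the
  index shifts \<open>j \<rightarrow> j + 1\<close> and \<open>k \<rightarrow> k + 1\<close> explicit, so that the terms at the boundary of the
  summation range need no separate discussion later.
\<close>

lemma summand_0: "summand (int m + 1) 0 k = summand (int m) 0 k"
proof (cases k)
  case 0
  then show ?thesis
    using qbinom_0[of "fps_X\<^sup>2" "Suc m"] qbinom_0[of "fps_X\<^sup>2" m]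
    by (simp add: summand_def add.commute)
qed (simp add: summand_def qbinom_eq_0)

lemma summand_Suc_0:
  "summand (int m + 1) (Suc j) 0 =
     summand (int m) (Suc j) 0 + fps_X ^ (2 * m + 2) * summand (int m) j 0"
proof (cases "j \<le> m")
  case True
  have "(Suc j)\<^sup>2 + Suc j + 2 * (m - j) = (2 * m + 2) + (j\<^sup>2 + j)"
    using True by (simp add: power2_eq_square)
  then have "fps_X ^ ((Suc j)\<^sup>2 + Suc j) * (fps_X\<^sup>2) ^ (m - j) =
      (fps_X ^ (2 * m + 2) * fps_X ^ (j\<^sup>2 + j) :: rat fps)"
    by (simp only: flip: power_add power_mult)
  moreover have "nat (int m - int j) = m - j"
    by simp
  ultimately show ?thesis
    using qbinom_pascal_upper[of "fps_X\<^sup>2" "int m" j] qbinom_0[of "fps_X\<^sup>2" "Suc j"]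
      qbinom_0[of "fps_X\<^sup>2" j]
    by (simp add: summand_def distrib_left del: power_Suc flip: mult.assoc)
next
  case False
  then show ?thesis
    by (simp add: summand_def qbinom_eq_0)
qed

text \<open>
  The upper Pascal rule splits off the summand for \<open>m\<close>; the remainder carries an extra factor
  \<open>q\<close> to the power \<open>2 * e\<close> with \<open>e = m - (k + 1) - j\<close>. The lower rule splits this remainder into a
  part that keeps the lower entry \<open>k + 1\<close> and a part that lowers it to \<open>k\<close>; in both, completing the
  squares leaves a power of \<open>q\<close> that depends on \<open>m\<close> alone.
\<close>

lemma summand_Suc_Suc:
  "summand (int m + 1) (Suc j) (Suc k) =
     summand (int m) (Suc j) (Suc k) + fps_X ^ (2 * m + 2) * summand (int m) j (Suc k)
       + fps_X ^ (2 * m + 1) * summand (int m - 1) j k"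
proof (cases "j + k < m")
  case True
  let ?X = "fps_X :: rat fps"
  let ?b = "qbinom (?X\<^sup>2)"
  define e where "e = m - Suc k - j"
  have e: "nat (int m - int (Suc k) - int j) = e"
    using True by (simp add: e_def)
  have m: "m = e + Suc k + j"
    using True by (simp add: e_def)
  have "(Suc j)\<^sup>2 + (Suc k)\<^sup>2 + Suc j + 2 * e + 2 * Suc k = (2 * m + 2) + (j\<^sup>2 + (Suc k)\<^sup>2 + j)"
    by (simp add: m power2_eq_square)
  then have 1: "?X ^ ((Suc j)\<^sup>2 + (Suc k)\<^sup>2 + Suc j) * (?X\<^sup>2) ^ e * (?X\<^sup>2) ^ Suc k =
      ?X ^ (2 * m + 2) * ?X ^ (j\<^sup>2 + (Suc k)\<^sup>2 + j)"
    by (simp only: flip: power_add power_mult)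
  have "(Suc j)\<^sup>2 + (Suc k)\<^sup>2 + Suc j + 2 * e = (2 * m + 1) + (j\<^sup>2 + k\<^sup>2 + j)"
    by (simp add: m power2_eq_square)
  then have 2: "?X ^ ((Suc j)\<^sup>2 + (Suc k)\<^sup>2 + Suc j) * (?X\<^sup>2) ^ e =
      ?X ^ (2 * m + 1) * ?X ^ (j\<^sup>2 + k\<^sup>2 + j)"
    by (simp only: flip: power_add power_mult)
  define c where "c = ?X ^ ((Suc j)\<^sup>2 + (Suc k)\<^sup>2 + Suc j)"
  define B where "B = ?b (int m - int (Suc k)) (int j)"
  have X0: "fps_nth (?X\<^sup>2) 0 = 0"
    by simp
  have "int m + 1 - int (Suc k) = int m - int (Suc k) + 1"
    by simp
  then have "summand (int m + 1) (Suc j) (Suc k) =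
      c * ?b (int m - int (Suc k) + 1) (int (Suc j)) * ?b (int (Suc j)) (int (Suc k))"
    by (simp only: summand_def c_def)
  also have "\<dots> = c * (?b (int m - int (Suc k)) (int (Suc j)) + (?X\<^sup>2) ^ e * B)
      * ?b (int (Suc j)) (int (Suc k))"
    by (simp only: qbinom_pascal_upper[OF X0] e B_def)
  also have "\<dots> = summand (int m) (Suc j) (Suc k)
      + c * (?X\<^sup>2) ^ e * B * ?b (int (Suc j)) (int (Suc k))"
    by (simp only: summand_def c_def distrib_left distrib_right mult.assoc)
  also have "c * (?X\<^sup>2) ^ e * B * ?b (int (Suc j)) (int (Suc k)) =
      c * (?X\<^sup>2) ^ e * (?X\<^sup>2) ^ Suc k * B * ?b (int j) (int (Suc k))
      + c * (?X\<^sup>2) ^ e * B * ?b (int j) (int k)"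
    by (simp only: qbinom_pascal_lower[OF X0] distrib_left mult_ac)
  also have "c * (?X\<^sup>2) ^ e * (?X\<^sup>2) ^ Suc k * B * ?b (int j) (int (Suc k)) =
      ?X ^ (2 * m + 2) * summand (int m) j (Suc k)"
    unfolding c_def 1 by (simp only: summand_def B_def mult.assoc)
  also have "c * (?X\<^sup>2) ^ e * B * ?b (int j) (int k) =
      ?X ^ (2 * m + 1) * summand (int m - 1) j k"
  proof -
    have "int m - int (Suc k) = int m - 1 - int k" by simp
    then show ?thesis
      unfolding c_def 2 by (simp only: summand_def B_def mult.assoc)
  qed
  finally show ?thesis by (simp only: add.assoc)
next
  case False
  then show ?thesis
    by (simp add: summand_def qbinom_eq_0)
qed

lemma double_sum_rec:
  "double_sum (int m + 1) =
     (1 + fps_X ^ (2 * m + 2)) * double_sum (int m) + fps_X ^ (2 * m + 1) * double_sum (int m - 1)"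
proof -
  let ?P = "fps_X ^ (2 * m + 2) :: rat fps" and ?Q = "fps_X ^ (2 * m + 1) :: rat fps"
  let ?t = "summand (int m)" and ?s = "summand (int m - 1)"
  have row: "(\<Sum>k\<le>Suc m. summand (int m + 1) (Suc j) k) =
      (\<Sum>k\<le>Suc m. ?t (Suc j) k) + ?P * (\<Sum>k\<le>Suc m. ?t j k) + ?Q * (\<Sum>k\<le>m. ?s j k)" for j
    unfolding sum.atMost_Suc_shift[of _ m] summand_Suc_0 summand_Suc_Suc
    by (simp add: sum.distrib sum_distrib_left algebra_simps)
  have "double_sum (int m + 1) = (\<Sum>j\<le>Suc m. \<Sum>k\<le>Suc m. summand (int m + 1) j k)"
    by (rule double_sum_eq) simp_all
  also have "\<dots> = (\<Sum>k\<le>Suc m. ?t 0 k) + (\<Sum>j\<le>m. \<Sum>k\<le>Suc m. summand (int m + 1) (Suc j) k)"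
    by (simp only: sum.atMost_Suc_shift[of _ m] summand_0)
  also have "\<dots> = (\<Sum>j\<le>Suc m. \<Sum>k\<le>Suc m. ?t j k)
      + ?P * (\<Sum>j\<le>m. \<Sum>k\<le>Suc m. ?t j k) + ?Q * (\<Sum>j\<le>m. \<Sum>k\<le>m. ?s j k)"
    unfolding row sum.atMost_Suc_shift[of "\<lambda>j. sum (?t j) {..Suc m}"]
    by (simp only: sum.distrib sum_distrib_left add.assoc)
  also have "(\<Sum>j\<le>Suc m. \<Sum>k\<le>Suc m. ?t j k) = double_sum (int m)"
    by (rule double_sum_eq[symmetric]) simp_all
  also have "(\<Sum>j\<le>m. \<Sum>k\<le>Suc m. ?t j k) = double_sum (int m)"
    by (rule double_sum_eq[symmetric]) simp_all
  also have "(\<Sum>j\<le>m. \<Sum>k\<le>m. ?s j k) = double_sum (int m - 1)"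
    by (rule double_sum_eq[symmetric]) simp_all
  finally show ?thesis
    by (simp add: distrib_right)
qed

lemma double_sum_neg:
  assumes "m < 0"
  shows "double_sum m = 0"
proof -
  have "summand m 0 0 = 0"
    using summand_nonzeroD[of m 0 0] assms by auto
  then show ?thesis
    using assms by (simp add: double_sum_eq[of m 0 0])
qed

lemma double_sum_0: "double_sum 0 = 1"
  using double_sum_eq[of 0 0 0] qbinom_0[of "fps_X\<^sup>2" 0] by (simp add: summand_def)

section \<open>Generating functions of weighted sets\<close>

definition gen_fun :: "('a \<Rightarrow> nat) \<Rightarrow> 'a set \<Rightarrow> rat fps" where
  "gen_fun w A = Abs_fps (\<lambda>N. of_nat (card {z \<in> A. w z = N}))"

lemma gen_fun_union:
  assumes "\<And>N. finite {z \<in> A. w z = N}" "\<And>N. finite {z \<in> B. w z = N}"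
  shows "gen_fun w (A \<union> B) + gen_fun w (A \<inter> B) = gen_fun w A + gen_fun w B"
proof (rule fps_ext)
  fix N
  have "{z \<in> A \<union> B. w z = N} = {z \<in> A. w z = N} \<union> {z \<in> B. w z = N}"
    and "{z \<in> A \<inter> B. w z = N} = {z \<in> A. w z = N} \<inter> {z \<in> B. w z = N}"
    by auto
  then show "fps_nth (gen_fun w (A \<union> B) + gen_fun w (A \<inter> B)) N =
      fps_nth (gen_fun w A + gen_fun w B) N"
    using card_Un_Int[OF assms(1)[of N] assms(2)[of N]] by (simp add: gen_fun_def flip: of_nat_add)
qed

lemma gen_fun_empty: "gen_fun w {} = 0"
  by (rule fps_ext) (simp add: gen_fun_def)

lemma gen_fun_image:
  assumes inj: "inj_on f A" and shift: "\<And>z. z \<in> A \<Longrightarrow> w' (f z) = w z + k"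
  shows "gen_fun w' (f ` A) = fps_X ^ k * gen_fun w A"
proof (rule fps_ext)
  fix N
  have "{z \<in> f ` A. w' z = N} = f ` {z \<in> A. w z + k = N}"
    using shift by auto
  then have "card {z \<in> f ` A. w' z = N} = card {z \<in> A. w z + k = N}"
    using inj by (auto intro!: card_image elim: inj_on_subset)
  also have "{z \<in> A. w z + k = N} = (if N < k then {} else {z \<in> A. w z = N - k})"
    by auto
  finally show "fps_nth (gen_fun w' (f ` A)) N = fps_nth (fps_X ^ k * gen_fun w A) N"
    by (simp add: gen_fun_def fps_X_power_mult_nth)
qed

section \<open>Two interlocking chains\<close>

text \<open>
  The conditions refer to the infinite sequences, not only to the positions below \<open>X\<close> and \<open>Y\<close>.
  Hence a zero at the last position of a chain leads to \<open>chain_pairs\<close> of a smaller shape, whatever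
  that shape is.
\<close>

definition chain_pairs :: "nat \<Rightarrow> nat \<Rightarrow> (parts \<times> parts) set" where
  "chain_pairs X Y = {(x, y). antimono x \<and> antimono y
     \<and> (\<forall>i. x (2 * i) \<ge> y (2 * i) \<and> y (2 * i) \<ge> x (2 * i + 2))
     \<and> (\<forall>i\<ge>X. x i = 0) \<and> (\<forall>i\<ge>Y. y i = 0)}"

fun pair_size :: "parts \<times> parts \<Rightarrow> nat" where
  "pair_size (x, y) = part_sum x + part_sum y"

lemma part_sum_eq:
  assumes "\<And>i. i \<ge> X \<Longrightarrow> x i = 0"
  shows "part_sum x = (\<Sum>i<X. x i)"
proof -
  have "{i. x i > 0} \<subseteq> {..<X}"
    using assms by (metis lessThan_iff less_irrefl mem_Collect_eq not_less subsetI)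
  then show ?thesis
    unfolding part_sum_def by (rule sum.mono_neutral_left[rotated]) auto
qed

lemma chain_pairs_finite: "finite {z \<in> chain_pairs X Y. pair_size z = N}"
proof -
  define B where "B n = {x. \<forall>i. (i \<in> {..<n} \<longrightarrow> x i \<in> {..N}) \<and> (i \<notin> {..<n} \<longrightarrow> x i = (0::nat))}"
    for n :: nat
  have le: "x i \<le> part_sum x" if "\<And>i. i \<ge> n \<Longrightarrow> x i = 0" for x :: parts and n i
  proof (cases "i < n")
    case True
    then show ?thesis
      by (simp add: part_sum_eq[of n x] that member_le_sum)
  qed (simp add: that)
  have "{z \<in> chain_pairs X Y. pair_size z = N} \<subseteq> B X \<times> B Y"
    unfolding chain_pairs_def B_def
    by (clarsimp simp: not_less) (metis add_leE le_add1 le_add2 le order_trans)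
  moreover have "finite (B n)" for n
    unfolding B_def by (rule finite_set_of_finite_funs) auto
  ultimately show ?thesis
    by (meson finite_SigmaI finite_subset)
qed

text \<open>
  The shapes for which the first \<open>X\<close> and \<open>Y\<close> positions form an up-set of the poset of the two
  chains, that is, for which adding 1 to all of these entries preserves the interlocking.
\<close>

definition admissible :: "nat \<Rightarrow> nat \<Rightarrow> bool" where
  "admissible X Y \<longleftrightarrow> (\<forall>i. (2 * i < Y \<longrightarrow> 2 * i < X) \<and> (2 * i + 2 < X \<longrightarrow> 2 * i < Y))"

definition raise :: "nat \<Rightarrow> parts \<Rightarrow> parts" where
  "raise n x = (\<lambda>i. if i < n then x i + 1 else 0)"

definition positive_pairs :: "nat \<Rightarrow> nat \<Rightarrow> (parts \<times> parts) set" where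
  "positive_pairs X Y = {(x, y) \<in> chain_pairs X Y. (\<forall>i<X. x i > 0) \<and> (\<forall>i<Y. y i > 0)}"

lemma raise_image:
  assumes adm: "admissible X Y"
  shows "map_prod (raise X) (raise Y) ` chain_pairs X Y = positive_pairs X Y"
proof (intro equalityI subsetI)
  fix z assume "z \<in> map_prod (raise X) (raise Y) ` chain_pairs X Y"
  then obtain x y where z: "z = (raise X x, raise Y y)" and xy: "(x, y) \<in> chain_pairs X Y"
    by auto
  have "antimono (raise X x)" "antimono (raise Y y)"
    using xy by (auto simp: chain_pairs_def raise_def antimono_def)
  moreover have "raise Y y (2 * i) \<le> raise X x (2 * i)"
      and "raise X x (2 * i + 2) \<le> raise Y y (2 * i)" for i
    using xy adm by (auto simp: chain_pairs_def raise_def admissible_def)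
  ultimately show "z \<in> positive_pairs X Y"
    by (auto simp: z positive_pairs_def chain_pairs_def raise_def)
next
  fix z assume z: "z \<in> positive_pairs X Y"
  then obtain x y where xy: "z = (x, y)" by (cases z)
  let ?x = "\<lambda>i. x i - 1" and ?y = "\<lambda>i. y i - 1"
  have "z = map_prod (raise X) (raise Y) (?x, ?y)"
    using z by (auto simp: xy positive_pairs_def chain_pairs_def raise_def fun_eq_iff)
  moreover have "(?x, ?y) \<in> chain_pairs X Y"
    using z by (auto simp: xy positive_pairs_def chain_pairs_def antimono_def diff_le_mono)
  ultimately show "z \<in> map_prod (raise X) (raise Y) ` chain_pairs X Y"
    by blast
qed

definition chain_gf :: "nat \<Rightarrow> nat \<Rightarrow> rat fps" where
  "chain_gf X Y = gen_fun pair_size (chain_pairs X Y)"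

lemma part_sum_raise:
  assumes "\<And>i. i \<ge> X \<Longrightarrow> x i = 0"
  shows "part_sum (raise X x) = part_sum x + X"
proof -
  have "part_sum (raise X x) = (\<Sum>i<X. raise X x i)"
    by (rule part_sum_eq) (simp add: raise_def)
  also have "\<dots> = (\<Sum>i<X. x i) + X"
    by (simp add: raise_def sum.distrib del: add_Suc_right add_Suc)
  finally show ?thesis
    by (simp add: part_sum_eq[of X x] assms)
qed

lemma positive_pairs_gf:
  assumes "admissible X Y"
  shows "gen_fun pair_size (positive_pairs X Y) = fps_X ^ (X + Y) * chain_gf X Y"
  unfolding raise_image[OF assms, symmetric] chain_gf_def
proof (rule gen_fun_image)
  have inj: "x = x'" if "raise n x = raise n x'" "\<forall>i\<ge>n. x i = 0" "\<forall>i\<ge>n. x' i = 0"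
    for n and x x' :: parts
  proof
    fix i show "x i = x' i"
      using fun_cong[OF that(1), of i] that(2,3) by (cases "i < n") (auto simp: raise_def)
  qed
  show "inj_on (map_prod (raise X) (raise Y)) (chain_pairs X Y)"
    by (rule inj_onI) (auto simp: chain_pairs_def dest: inj)
next
  fix z assume "z \<in> chain_pairs X Y"
  then show "pair_size (map_prod (raise X) (raise Y) z) = pair_size z + (X + Y)"
    by (auto simp: chain_pairs_def part_sum_raise)
qed

lemma antimono_all_positive_iff:
  fixes x :: parts
  assumes "antimono x"
  shows "(\<forall>i<Suc n. x i > 0) \<longleftrightarrow> x n \<noteq> 0"
proof
  assume "x n \<noteq> 0"
  then show "\<forall>i<Suc n. x i > 0"
    using antimonoD[OF assms] by (metis less_Suc_eq_le less_le_trans not_gr_zero)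
qed auto

lemma all_ge_0_iff: "(\<forall>i\<ge>n. x i = 0) \<longleftrightarrow> (\<forall>i\<ge>Suc n. x i = 0) \<and> x n = 0"
  for x :: parts
proof (intro iffI allI impI)
  fix i assume "(\<forall>i\<ge>Suc n. x i = 0) \<and> x n = 0" "n \<le> i"
  then show "x i = 0"
    by (cases "i = n") simp_all
qed auto

lemma chain_pairs_last_x:
  "(x, y) \<in> chain_pairs X Y \<longleftrightarrow> (x, y) \<in> chain_pairs (Suc X) Y \<and> x X = 0"
  using all_ge_0_iff[of X x] by (auto simp: chain_pairs_def)

lemma chain_pairs_last_y:
  "(x, y) \<in> chain_pairs X Y \<longleftrightarrow> (x, y) \<in> chain_pairs X (Suc Y) \<and> y Y = 0"
  using all_ge_0_iff[of Y y] by (auto simp: chain_pairs_def)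

lemma chain_pairs_antimono:
  assumes "(x, y) \<in> chain_pairs X Y"
  shows "antimono x" "antimono y"
  using assms by (simp_all add: chain_pairs_def)

text \<open>
  The pairs whose two chains are not both positive throughout are those with a zero at one of the
  last two positions; they are counted by inclusion and exclusion. The others are, after
  subtracting 1 everywhere, all pairs again.
\<close>

lemma chain_gf_Suc_Suc:
  assumes "admissible (Suc X) (Suc Y)"
  shows "(1 - fps_X ^ (X + Y + 2)) * chain_gf (Suc X) (Suc Y) =
    chain_gf X (Suc Y) + chain_gf (Suc X) Y - chain_gf X Y"
proof -
  let ?A = "chain_pairs X (Suc Y)" and ?B = "chain_pairs (Suc X) Y"
    and ?P = "positive_pairs (Suc X) (Suc Y)"
  have P: "(x, y) \<in> ?P \<longleftrightarrow> (x, y) \<in> chain_pairs (Suc X) (Suc Y) \<and> x X \<noteq> 0 \<and> y Y \<noteq> 0" for x y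
    unfolding positive_pairs_def mem_Collect_eq prod.case
    using chain_pairs_antimono antimono_all_positive_iff by metis
  have split: "chain_pairs (Suc X) (Suc Y) = (?A \<union> ?B) \<union> ?P"
    and disj: "(?A \<union> ?B) \<inter> ?P = {}" and int: "?A \<inter> ?B = chain_pairs X Y"
    using chain_pairs_last_x[of _ _ X "Suc Y"] chain_pairs_last_x[of _ _ X Y]
      chain_pairs_last_y[of _ _ "Suc X" Y] P by auto
  have fin: "finite {z \<in> ?A \<union> ?B. pair_size z = N}" "finite {z \<in> ?P. pair_size z = N}" for N
    by (rule finite_subset[OF _ chain_pairs_finite[of "Suc X" "Suc Y" N]], use split in blast)+
  have "chain_gf (Suc X) (Suc Y) =
      gen_fun pair_size (?A \<union> ?B) + fps_X ^ (X + Y + 2) * chain_gf (Suc X) (Suc Y)"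
    using gen_fun_union[OF fin] positive_pairs_gf[OF assms]
    unfolding disj split[symmetric] by (simp add: chain_gf_def[of "Suc X" "Suc Y"] gen_fun_empty)
  moreover have "gen_fun pair_size (?A \<union> ?B) + chain_gf X Y = chain_gf X (Suc Y) + chain_gf (Suc X) Y"
    using gen_fun_union[OF chain_pairs_finite chain_pairs_finite, of X "Suc Y" "Suc X" Y]
    by (simp add: chain_gf_def int)
  ultimately show ?thesis
    by (metis (no_types, lifting) add_diff_cancel_right' left_diff_distrib mult_1)
qed

lemma chain_gf_Suc_0:
  assumes "admissible (Suc X) 0"
  shows "(1 - fps_X ^ Suc X) * chain_gf (Suc X) 0 = chain_gf X 0"
proof -
  let ?A = "chain_pairs X 0" and ?P = "positive_pairs (Suc X) 0"
  have P: "(x, y) \<in> ?P \<longleftrightarrow> (x, y) \<in> chain_pairs (Suc X) 0 \<and> x X \<noteq> 0" for x y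
    unfolding positive_pairs_def mem_Collect_eq prod.case
    using chain_pairs_antimono(1) antimono_all_positive_iff by (metis less_nat_zero_code)
  have split: "chain_pairs (Suc X) 0 = ?A \<union> ?P" and disj: "?A \<inter> ?P = {}"
    using chain_pairs_last_x[of _ _ X 0] P by auto
  have fin: "finite {z \<in> ?P. pair_size z = N}" for N
    by (rule finite_subset[OF _ chain_pairs_finite[of "Suc X" 0 N]]) (use split in blast)
  show ?thesis
    using gen_fun_union[OF chain_pairs_finite fin, of X 0] positive_pairs_gf[OF assms]
    unfolding disj split[symmetric] by (simp add: chain_gf_def gen_fun_empty algebra_simps)
qed

lemma chain_gf_0_0: "chain_gf 0 0 = 1"
proof -
  have "chain_pairs 0 0 = {(\<lambda>_. 0, \<lambda>_. 0)}"
    by (auto simp: chain_pairs_def antimono_def)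
  then have "{z \<in> chain_pairs 0 0. pair_size z = N} = (if N = 0 then {(\<lambda>_. 0, \<lambda>_. 0)} else {})" for N
    by (auto simp: part_sum_def)
  then show ?thesis
    by (intro fps_ext) (simp add: chain_gf_def gen_fun_def)
qed

section \<open>The numerators\<close>

text \<open>
  Clearing denominators turns \<open>chain_gf_Suc_Suc\<close> into a recurrence with polynomial coefficients.
  By the theory of P-partitions, for admissible shapes these are the generating functions of the
  major index over the linear extensions of the poset.
\<close>

definition numerator :: "nat \<Rightarrow> nat \<Rightarrow> rat fps" where
  "numerator X Y = qpoch fps_X fps_X (X + Y) * chain_gf X Y"

lemma numerator_Suc_Suc:
  assumes "admissible (Suc X) (Suc Y)"
  shows "numerator (Suc X) (Suc Y) =
    numerator X (Suc Y) + numerator (Suc X) Y - (1 - fps_X ^ (X + Y + 1)) * numerator X Y"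
proof -
  let ?c = "qpoch fps_X fps_X (X + Y) * (1 - fps_X ^ (X + Y + 1))"
  have "numerator (Suc X) (Suc Y) =
      ?c * ((1 - fps_X ^ (X + Y + 2)) * chain_gf (Suc X) (Suc Y))"
    by (simp add: numerator_def qpoch_Suc)
  then show ?thesis
    unfolding chain_gf_Suc_Suc[OF assms]
    by (simp add: numerator_def qpoch_Suc algebra_simps)
qed

lemma numerator_Suc_0: "admissible (Suc X) 0 \<Longrightarrow> numerator (Suc X) 0 = numerator X 0"
  using chain_gf_Suc_0[of X] by (simp add: numerator_def qpoch_Suc mult.assoc)

text \<open>
  If \<open>(X, Y + 1)\<close> is not an admissible shape, then the zero of \<open>x\<close> at \<open>X\<close> already forces the last
  entry of \<open>y\<close> to vanish. Two terms of the recurrence then cancel; \<open>numerator_forced_x\<close> is the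
  analogue with the chains exchanged.
\<close>

lemma numerator_forced_y:
  assumes "admissible (Suc X) (Suc Y)" "even X" "X \<le> Y"
  shows "numerator (Suc X) (Suc Y) = numerator (Suc X) Y"
proof -
  have "y Y = 0" if "(x, y) \<in> chain_pairs X (Suc Y)" for x y
  proof -
    have "y Y \<le> y X"
      using that assms(3) by (auto simp: chain_pairs_def antimono_def)
    moreover have "y (2 * (X div 2)) \<le> x (2 * (X div 2))" and "x X = 0"
      using that by (auto simp: chain_pairs_def)
    ultimately show ?thesis
      using assms(2) by simp
  qed
  then have "chain_pairs X (Suc Y) = chain_pairs X Y"
    using chain_pairs_last_y[of _ _ X Y] by auto
  then have "numerator X (Suc Y) = (1 - fps_X ^ (X + Y + 1)) * numerator X Y"
    by (simp add: numerator_def chain_gf_def qpoch_Suc)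
  then show ?thesis
    using numerator_Suc_Suc[OF assms(1)] by simp
qed

lemma numerator_forced_x:
  assumes "admissible (Suc X) (Suc Y)" "even Y" "Y + 2 \<le> X"
  shows "numerator (Suc X) (Suc Y) = numerator X (Suc Y)"
proof -
  have "x X = 0" if "(x, y) \<in> chain_pairs (Suc X) Y" for x y
  proof -
    have "x X \<le> x (Y + 2)"
      using that assms(3) by (auto simp: chain_pairs_def antimono_def)
    moreover have "x (2 * (Y div 2) + 2) \<le> y (2 * (Y div 2))" and "y Y = 0"
      using that by (auto simp: chain_pairs_def)
    ultimately show ?thesis
      using assms(2) by simp
  qed
  then have "chain_pairs (Suc X) Y = chain_pairs X Y"
    using chain_pairs_last_x[of _ _ X Y] by auto
  then have "numerator (Suc X) Y = (1 - fps_X ^ (X + Y + 1)) * numerator X Y"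
    by (simp add: numerator_def chain_gf_def qpoch_Suc)
  then show ?thesis
    using numerator_Suc_Suc[OF assms(1)] by simp
qed

text \<open>
  On the shapes \<open>(M, M)\<close> and \<open>(M + 1, M - 1)\<close> the numerator follows one of two patterns, depending
  on the parity of \<open>M\<close>: one of the two shapes is forced, and the other one is expressed by the
  numerators of \<open>(M, M - 1)\<close> and \<open>(M - 1, M - 2)\<close> as in the following two lemmas.
\<close>

lemma numerator_diagonal:
  "numerator (2 * i + 2) (2 * i + 2) =
     numerator (2 * i + 2) (2 * i + 1) + fps_X ^ (4 * i + 3) * numerator (2 * i + 1) (2 * i)"
proof -
  have adm: "admissible (Suc (2 * i)) (Suc (2 * i))" "admissible (Suc (2 * i)) (Suc (2 * i + 1))"
      "admissible (Suc (2 * i + 1)) (Suc (2 * i + 1))"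
    unfolding admissible_def by presburger+
  have "numerator (Suc (2 * i)) (Suc (2 * i)) = numerator (Suc (2 * i)) (2 * i)"
    by (rule numerator_forced_y[OF adm(1)]) simp_all
  moreover have "numerator (Suc (2 * i)) (Suc (2 * i + 1)) = numerator (Suc (2 * i)) (2 * i + 1)"
    by (rule numerator_forced_y[OF adm(2)]) simp_all
  moreover have eqs: "2 * i + 1 + (2 * i + 1) + 1 = 4 * i + 3"
      "Suc (2 * i) = 2 * i + 1" "Suc (2 * i + 1) = 2 * i + 2"
    by simp_all
  ultimately show ?thesis
    using numerator_Suc_Suc[OF adm(3)] unfolding eqs by (simp add: left_diff_distrib)
qed

lemma numerator_off_diagonal:
  "numerator (2 * i + 4) (2 * i + 2) =
     numerator (2 * i + 3) (2 * i + 2) + fps_X ^ (4 * i + 5) * numerator (2 * i + 2) (2 * i + 1)"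
proof -
  have adm: "admissible (Suc (2 * i + 2)) (Suc (2 * i))" "admissible (Suc (2 * i + 3)) (Suc (2 * i))"
      "admissible (Suc (2 * i + 3)) (Suc (2 * i + 1))"
    unfolding admissible_def by presburger+
  have "numerator (Suc (2 * i + 2)) (Suc (2 * i)) = numerator (2 * i + 2) (Suc (2 * i))"
    by (rule numerator_forced_x[OF adm(1)]) simp_all
  moreover have "numerator (Suc (2 * i + 3)) (Suc (2 * i)) = numerator (2 * i + 3) (Suc (2 * i))"
    by (rule numerator_forced_x[OF adm(2)]) simp_all
  moreover have eqs: "2 * i + 3 + (2 * i + 1) + 1 = 4 * i + 5"
      "Suc (2 * i + 2) = 2 * i + 3" "Suc (2 * i + 3) = 2 * i + 4"
      "Suc (2 * i) = 2 * i + 1" "Suc (2 * i + 1) = 2 * i + 2"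
    by simp_all
  ultimately show ?thesis
    using numerator_Suc_Suc[OF adm(3)] unfolding eqs by (simp add: left_diff_distrib)
qed

text \<open>
  The parity disappears: the two preceding shapes \<open>(M, M)\<close> and \<open>(M + 1, M - 1)\<close>, with \<open>M = m + 2\<close>,
  exchange their roles when the parity of \<open>m\<close> changes, but only their sum enters.
\<close>

lemma numerator_rec:
  "numerator (Suc (Suc (Suc m))) (Suc (Suc m)) =
     (1 + fps_X ^ (2 * m + 4)) * numerator (Suc (Suc m)) (Suc m)
       + fps_X ^ (2 * m + 3) * numerator (Suc m) m"
proof -
  let ?M = "Suc (Suc m)"
  have adm: "admissible (Suc ?M) ?M"
    unfolding admissible_def by presburger
  have "numerator ?M ?M + numerator (Suc ?M) (Suc m) =
      2 * numerator ?M (Suc m) + fps_X ^ (2 * m + 3) * numerator (Suc m) m"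
  proof (cases "even m")
    case True
    then obtain i where i: "m = 2 * i" by (elim evenE)
    have "admissible (Suc (2 * i + 2)) (Suc (2 * i))"
      unfolding admissible_def by presburger
    then have "numerator (Suc (2 * i + 2)) (Suc (2 * i)) = numerator (2 * i + 2) (Suc (2 * i))"
      by (rule numerator_forced_x) simp_all
    then show ?thesis
      using numerator_diagonal[of i] by (simp add: i)
  next
    case False
    then obtain i where i: "m = 2 * i + 1" by (elim oddE)
    have "admissible (Suc (2 * i + 2)) (Suc (2 * i + 2))"
      unfolding admissible_def by presburger
    then have "numerator (Suc (2 * i + 2)) (Suc (2 * i + 2)) = numerator (Suc (2 * i + 2)) (2 * i + 2)"
      by (rule numerator_forced_y) simp_all
    then show ?thesis
      using numerator_off_diagonal[of i] by (simp add: i numeral_eq_Suc)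
  qed
  moreover have eq: "?M + Suc m + 1 = 2 * m + 4"
    by simp
  ultimately show ?thesis
    using numerator_Suc_Suc[OF adm] unfolding eq by (simp add: left_diff_distrib distrib_right)
qed

lemma numerator_eq_double_sum:
  "numerator (Suc m) m = double_sum (int m)"
proof (induction m rule: induct_nat_012)
  case 0
  have "numerator 1 0 = numerator 0 0"
    using numerator_Suc_0[of 0] by (simp add: admissible_def)
  then show ?case
    by (simp add: double_sum_0 numerator_def chain_gf_0_0 qpoch_def)
next
  case 1
  \<comment> \<open>The recurrence for \<open>numerator\<close> starts one step later than that of \<open>double_sum\<close>, whose value at \<open>-1\<close>
    is 0; here the first chain has length at most 2 and the second at most 1.\<close>
  have adm: "admissible (Suc 0) 0" "admissible (Suc 1) 0" "admissible (Suc 0) (Suc 0)"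
      "admissible (Suc 1) (Suc 0)"
    unfolding admissible_def by presburger+
  have one: "numerator 1 0 = 1"
    using numerator_Suc_0[OF adm(1)] by (simp add: numerator_def chain_gf_0_0 qpoch_def)
  moreover have "numerator 2 0 = 1"
    using numerator_Suc_0[OF adm(2)] one by (simp add: numeral_2_eq_2)
  moreover have "numerator 1 1 = 1"
    using numerator_forced_y[OF adm(3)] one by simp
  ultimately have "numerator 2 1 = 1 + fps_X\<^sup>2"
    using numerator_Suc_Suc[OF adm(4)] by (simp add: numeral_2_eq_2)
  moreover have "double_sum 1 = 1 + fps_X\<^sup>2"
    using double_sum_rec[of 0] by (simp add: double_sum_0 double_sum_neg power2_eq_square)
  ultimately show ?case
    by (simp add: numeral_2_eq_2)
next
  case (ge2 m)
  have eqs: "2 * Suc m + 2 = 2 * m + 4" "2 * Suc m + 1 = 2 * m + 3"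
      "int (Suc m) + 1 = int (Suc (Suc m))" "int (Suc m) - 1 = int m"
    by simp_all
  show ?case
    using double_sum_rec[of "Suc m"] unfolding eqs by (simp only: numerator_rec ge2.IH)
qed

section \<open>Plane partitions as interlocking chains\<close>

text \<open>
  The relations \<open>\<lambda>\<^sup>1 \<succeq> \<lambda>\<^sup>0\<close> and \<open>\<lambda>\<^sup>2 \<succeq> \<lambda>\<^sup>3\<close> say that the parts of the two partitions alternate in a
  single weakly decreasing sequence; \<open>diagonals\<close> takes such sequences apart.
\<close>

definition diagonals :: "parts \<times> parts \<Rightarrow> parts4" where
  "diagonals = (\<lambda>(x, y). (\<lambda>i. x (2 * i + 1), \<lambda>i. x (2 * i), \<lambda>i. y (2 * i), \<lambda>i. y (2 * i + 1)))"

definition merge :: "parts \<Rightarrow> parts \<Rightarrow> parts" where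
  "merge p r = (\<lambda>i. if even i then p (i div 2) else r (i div 2))"

lemma merge_simps [simp]: "merge p r (2 * i) = p i" "merge p r (Suc (2 * i)) = r i"
  by (simp_all add: merge_def)

lemma antimono_iff_interlaces:
  "antimono x \<longleftrightarrow> (\<lambda>i. x (2 * i)) \<succeq> (\<lambda>i. x (2 * i + 1))" for x :: parts
proof
  assume "antimono x"
  then show "(\<lambda>i. x (2 * i)) \<succeq> (\<lambda>i. x (2 * i + 1))"
    by (simp add: interlaces_def antimono_def)
next
  assume *: "(\<lambda>i. x (2 * i)) \<succeq> (\<lambda>i. x (2 * i + 1))"
  have "x (Suc i) \<le> x i" for i
  proof (cases "even i")
    case True
    then obtain k where "i = 2 * k" by (elim evenE)
    then show ?thesis using * by (simp add: interlaces_def)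
  next
    case False
    then obtain k where "i = 2 * k + 1" by (elim oddE)
    then show ?thesis using * by (simp add: interlaces_def)
  qed
  then show "antimono x"
    by (simp add: antimono_iff_le_Suc)
qed

text \<open>
  The positive parts of a partition come first, so bounding their number means bounding their
  positions.
\<close>

lemma partition_num_parts_le_iff:
  "is_partition p \<and> num_parts p \<le> n \<longleftrightarrow> antimono p \<and> (\<forall>i\<ge>n. p i = 0)"
proof (intro iffI conjI allI impI)
  assume p: "is_partition p \<and> num_parts p \<le> n"
  then show "antimono p"
    by (simp add: is_partition_def)
  fix i assume "n \<le> i"
  show "p i = 0"
  proof (rule ccontr)
    assume "p i \<noteq> 0"
    then have "p k > 0" if "k \<le> i" for k
      using antimonoD[OF \<open>antimono p\<close> that] by simp
    then have "{..i} \<subseteq> {i. p i > 0}"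
      by auto
    then have "card {..i} \<le> num_parts p"
      using p unfolding num_parts_def is_partition_def by (blast intro: card_mono)
    then show False
      using p \<open>n \<le> i\<close> by simp
  qed
next
  assume p: "antimono p \<and> (\<forall>i\<ge>n. p i = 0)"
  then have sub: "{i. p i > 0} \<subseteq> {..<n}"
    by (metis lessThan_iff less_irrefl mem_Collect_eq not_less subsetI)
  then show "is_partition p"
    using p by (auto simp: is_partition_def intro: finite_subset)
  show "num_parts p \<le> n"
    using card_mono[OF _ sub] by (simp add: num_parts_def)
qed

lemma mem_DSPP_100_iff:
  "(l0, l1, l2, l3) \<in> DSPP (1, 0, 0) n \<longleftrightarrow>
     (\<forall>p \<in> {l0, l1, l2, l3}. antimono p \<and> (\<forall>i\<ge>n. p i = 0)) \<and> l1 \<succeq> l0 \<and> l1 \<succeq> l2 \<and> l2 \<succeq> l3"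
  by (auto simp: DSPP_def profile_step_def simp flip: partition_num_parts_le_iff)

lemma all_ge_double_iff:
  "(\<forall>i\<ge>2 * n. x i = 0) \<longleftrightarrow> (\<forall>i\<ge>n. x (2 * i) = 0) \<and> (\<forall>i\<ge>n. x (2 * i + 1) = 0)" for x :: parts
proof (intro iffI conjI allI impI)
  fix i
  assume *: "(\<forall>i\<ge>n. x (2 * i) = 0) \<and> (\<forall>i\<ge>n. x (2 * i + 1) = 0)" and i: "2 * n \<le> i"
  have "n \<le> i div 2"
    using i by simp
  then show "x i = 0"
    using * by (cases "even i") (auto elim!: evenE oddE)
qed auto

lemma diagonals_mem_iff: "diagonals (x, y) \<in> DSPP (1, 0, 0) n \<longleftrightarrow> (x, y) \<in> chain_pairs (2 * n) (2 * n)"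
proof -
  have "antimono (\<lambda>i. z (2 * i))" "antimono (\<lambda>i. z (2 * i + 1))" if "antimono z" for z :: parts
    using that by (auto simp: antimono_def)
  then show ?thesis
    unfolding diagonals_def prod.case mem_DSPP_100_iff chain_pairs_def mem_Collect_eq
      all_ge_double_iff antimono_iff_interlaces[symmetric]
    by (auto simp: interlaces_def)
qed

lemma diagonals_image: "diagonals ` chain_pairs (2 * n) (2 * n) = DSPP (1, 0, 0) n"
proof (intro equalityI subsetI)
  fix L assume L: "L \<in> DSPP (1, 0, 0) n"
  obtain l0 l1 l2 l3 where l: "L = (l0, l1, l2, l3)"
    by (cases L)
  have "L = diagonals (merge l1 l0, merge l2 l3)"
    by (simp add: l diagonals_def)
  with L show "L \<in> diagonals ` chain_pairs (2 * n) (2 * n)"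
    using diagonals_mem_iff by blast
qed (auto simp: diagonals_mem_iff simp del: One_nat_def)

lemma inj_diagonals: "inj diagonals"
proof (rule injI, clarify)
  fix x y x' y' assume *: "diagonals (x, y) = diagonals (x', y')"
  have eq: "z = z'" if even: "(\<lambda>i. z (2 * i)) = (\<lambda>i. z' (2 * i))"
      and odd: "(\<lambda>i. z (2 * i + 1)) = (\<lambda>i. z' (2 * i + 1))" for z z' :: parts
  proof
    fix i show "z i = z' i"
      using fun_cong[OF even, of "i div 2"] fun_cong[OF odd, of "i div 2"]
      by (cases "even i") simp_all
  qed
  show "x = x' \<and> y = y'"
    using * unfolding diagonals_def prod.case prod.inject by (blast intro: eq[of x x'] eq[of y y'])
qed

lemma part_sum_even_odd:
  assumes "\<And>i. i \<ge> 2 * n \<Longrightarrow> x i = 0"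
  shows "part_sum x = part_sum (\<lambda>i. x (2 * i)) + part_sum (\<lambda>i. x (2 * i + 1))"
proof -
  have "(\<Sum>i<2 * n. x i) = (\<Sum>i<n. x (2 * i)) + (\<Sum>i<n. x (2 * i + 1))"
    by (induction n) simp_all
  moreover have "part_sum x = (\<Sum>i<2 * n. x i)"
    by (rule part_sum_eq[OF assms])
  moreover have "part_sum (\<lambda>i. x (2 * i)) = (\<Sum>i<n. x (2 * i))"
      and "part_sum (\<lambda>i. x (2 * i + 1)) = (\<Sum>i<n. x (2 * i + 1))"
    by (rule part_sum_eq, rule assms, simp)+
  ultimately show ?thesis
    by simp
qed

lemma DSPP_gf_eq_chain_gf: "DSPP_gf (1, 0, 0) n = chain_gf (2 * n) (2 * n)"
proof -
  have "dspp_size (diagonals z) = pair_size z + 0" if z: "z \<in> chain_pairs (2 * n) (2 * n)" for z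
  proof -
    obtain x y where xy: "z = (x, y)"
      by (cases z)
    have "part_sum x = part_sum (\<lambda>i. x (2 * i)) + part_sum (\<lambda>i. x (2 * i + 1))"
        and "part_sum y = part_sum (\<lambda>i. y (2 * i)) + part_sum (\<lambda>i. y (2 * i + 1))"
      using z by (auto intro!: part_sum_even_odd[of n] simp: xy chain_pairs_def simp del: One_nat_def add_Suc_right)
    then show ?thesis
      by (simp only: xy diagonals_def prod.case dspp_size.simps pair_size.simps)
  qed
  then have "gen_fun dspp_size (diagonals ` chain_pairs (2 * n) (2 * n)) =
      fps_X ^ 0 * gen_fun pair_size (chain_pairs (2 * n) (2 * n))"
    by (intro gen_fun_image inj_on_subset[OF inj_diagonals]) auto
  then show ?thesis
    by (simp add: diagonals_image chain_gf_def) (simp add: DSPP_gf_def gen_fun_def)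
qed

theorem theorem6p5:
  fixes n :: nat
  assumes "n \<ge> 1"
  shows "P100 n =
    Sum_any (\<lambda>(j :: nat, k :: nat).
      fps_X ^ (j\<^sup>2 + k\<^sup>2 + j) * qbinom (fps_X\<^sup>2) (2 * int n - int k - 1) (int j)
        * qbinom (fps_X\<^sup>2) (int j) (int k))
    + fps_X ^ (4 * n - 1) * Sum_any (\<lambda>(j :: nat, k :: nat).
      fps_X ^ (j\<^sup>2 + k\<^sup>2 + j) * qbinom (fps_X\<^sup>2) (2 * int n - int k - 2) (int j)
        * qbinom (fps_X\<^sup>2) (int j) (int k))"
proof -
  obtain i where n: "n = Suc i"
    using assms by (cases n) auto
  have swap: "2 * int n - int k - c = (2 * int n - c) - int k" for k c
    by simp
  have "4 * n = 2 * n + 2 * n" "2 * n = 2 * i + 2"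
    by (simp_all add: n)
  then have "P100 n = numerator (2 * i + 2) (2 * i + 2)"
    by (simp only: P100_def DSPP_gf_eq_chain_gf numerator_def)
  also have "\<dots> = double_sum (2 * int n - 1) + fps_X ^ (4 * n - 1) * double_sum (2 * int n - 2)"
    using numerator_diagonal[of i] numerator_eq_double_sum[of "2 * i + 1"]
      numerator_eq_double_sum[of "2 * i"]
    by (simp add: n algebra_simps)
  finally show ?thesis
    unfolding swap by (simp only: double_sum_def summand_def)
qed

end
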